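(* Consider the TV-ARMA($p,q$) equation with deterministic coefficients $y_t=\varphi(t)+\sum_{m=1}^{p}\phi_m(t)y_{t-m}+\varepsilon_t+\sum_{l=1}^{q}\theta_l(t)\varepsilon_{t-l}$, $t\in\mathbb{Z}$. Suppose the absolute summability condition $\sum_{r=-\infty}^{t}|\xi(t,r)|<\infty$ holds for all $t$, and that $\varphi(t)$ and $\theta_l(t)$ ($1\le l\le q$) are bounded functions of $t$. Then there exists a solution of the equation in $L_2$ of the form $$y_t=\sum_{r=-\infty}^{t}\xi(t,r)\varphi(r)+\sum_{r=-\infty}^{t}\xi_q(t,r)\varepsilon_r .$$
   Context: Let $p,q\ge 1$ be integers and $L_2=L_2(\Omega,\mathcal F,P)$. The coefficients $\varphi(t),\phi_m(t),\theta_l(t)$ are deterministic real-valued functions of $t\in\mathbb{Z}$. The errors satisfy $\mathbb{E}(\varepsilon_t)=0$, $\mathbb{E}(\varepsilon_t\varepsilon_s)=0$ for $s\ne t$, $\mathbb{E}(\varepsilon_t\mid y_s,s<t)=0$, $\mathbb{E}(\varepsilon_t^2)=\sigma^2(t)$ with $0<\sigma^2(t)\le M<\infty$ for all $t$ and some $M$. Infinite sums of random variables are understood as limits in $L_2$. Principal determinant: for integers $s<t$, $\xi(t,s)=\det(\mathbf{\Phi}_{t,s})$, where $\mathbf{\Phi}_{t,s}$ is the $(t-s)\times(t-s)$ matrix whose $(i,j)$ entry is $\phi_{i-j+1}(s+i)$ if $0\le i-j\le p-1$, $-1$ if $j=i+1$, and $0$ otherwise. Moreover $\xi(t,t)=1$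 and $\xi(t,s)=0$ for $t<s$. Also $\xi_q(t,r)=\xi(t,r)+\sum_{l=1}^{q}\xi(t,r+l)\theta_l(r+l)$. *)

theory Defs
  imports "HOL-Probability.Probability" "Jordan_Normal_Form.Determinant"
begin

text \<open>
  The coefficients are functions on the integers: \<open>\<phi>0 t\<close> is the drift at time \<open>t\<close>, \<open>\<phi> m t\<close> is the coefficient
  of \<open>y (t - m)\<close>, \<open>\<theta> l t\<close> that of \<open>\<epsilon> (t - l)\<close>. Only \<open>\<phi> m\<close> with \<open>m \<in> {1..p}\<close> and \<open>\<theta> l\<close> with \<open>l \<in> {1..q}\<close>
  are ever used.
\<close>

text \<open>
  Matrix indices start at 0, so the entry at \<open>(i, j)\<close> below is the usual \<open>(i + 1, j + 1)\<close> entry; hence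
  the time argument \<open>s + i + 1\<close>.
\<close>

definition principal_matrix :: "nat \<Rightarrow> (nat \<Rightarrow> int \<Rightarrow> real) \<Rightarrow> int \<Rightarrow> int \<Rightarrow> real mat" where
  "principal_matrix p \<phi> t s =
     mat (nat (t - s)) (nat (t - s))
       (\<lambda>(i, j). if j \<le> i \<and> i - j \<le> p - 1 then \<phi> (i - j + 1) (s + int i + 1)
                 else if j = i + 1 then -1
                 else 0)"

definition xi :: "nat \<Rightarrow> (nat \<Rightarrow> int \<Rightarrow> real) \<Rightarrow> int \<Rightarrow> int \<Rightarrow> real" where
  "xi p \<phi> t s =
     (if s < t then Determinant.det (principal_matrix p \<phi> t s)
      else if s = t then 1
      else 0)"

definition xi_q ::
  "nat \<Rightarrow> nat \<Rightarrow> (nat \<Rightarrow> int \<Rightarrow> real) \<Rightarrow> (nat \<Rightarrow> int \<Rightarrow> real) \<Rightarrow> int \<Rightarrow> int \<Rightarrow> real" where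
  "xi_q p q \<phi> \<theta> t r =
     xi p \<phi> t r + (\<Sum>l = 1..q. xi p \<phi> t (r + int l) * \<theta> l (r + int l))"

definition L2 :: "'a measure \<Rightarrow> ('a \<Rightarrow> real) set" where
  "L2 M = {X \<in> borel_measurable M. integrable M (\<lambda>\<omega>. (X \<omega>)\<^sup>2)}"

text \<open>
  \<open>has_L2_sum M X t Z\<close>: the series of the \<open>X r\<close> over \<open>r\<close> from minus infinity to \<open>t\<close> converges to \<open>Z\<close> in
  mean square. Requiring \<open>Z\<close> and the \<open>X r\<close> to be square integrable makes each integral a genuine squared
  \<open>L2\<close> distance and not the default value 0 of the Bochner integral.
\<close>

definition has_L2_sum :: "'a measure \<Rightarrow> (int \<Rightarrow> 'a \<Rightarrow> real) \<Rightarrow> int \<Rightarrow> ('a \<Rightarrow> real) \<Rightarrow> bool" where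
  "has_L2_sum M X t Z \<longleftrightarrow>
     (\<forall>r\<le>t. X r \<in> L2 M) \<and> Z \<in> L2 M \<and>
     ((\<lambda>s. \<integral>\<omega>. ((\<Sum>r = s..t. X r \<omega>) - Z \<omega>)\<^sup>2 \<partial>M) \<longlongrightarrow> 0) at_bot"

definition L2_solution ::
  "'a measure \<Rightarrow> nat \<Rightarrow> nat \<Rightarrow> (int \<Rightarrow> real) \<Rightarrow> (nat \<Rightarrow> int \<Rightarrow> real) \<Rightarrow> (nat \<Rightarrow> int \<Rightarrow> real) \<Rightarrow>
   (int \<Rightarrow> 'a \<Rightarrow> real) \<Rightarrow> (int \<Rightarrow> 'a \<Rightarrow> real) \<Rightarrow> bool" where
  "L2_solution M p q \<phi>0 \<phi> \<theta> \<epsilon> y \<longleftrightarrow>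
     (\<forall>t. y t \<in> L2 M) \<and>
     (\<forall>t. AE \<omega> in M.
        y t \<omega> = \<phi>0 t + (\<Sum>m = 1..p. \<phi> m t * y (t - int m) \<omega>)
                + \<epsilon> t \<omega> + (\<Sum>l = 1..q. \<theta> l t * \<epsilon> (t - int l) \<omega>))"

text \<open>
  The deterministic part is an ordinary (unordered) real series; its convergence is stated separately because
  \<open>infsum\<close> of a non-summable family is 0. The random part is an \<open>L2\<close> limit and therefore determined only
  almost surely.
\<close>

definition has_explicit_form ::
  "'a measure \<Rightarrow> nat \<Rightarrow> nat \<Rightarrow> (int \<Rightarrow> real) \<Rightarrow> (nat \<Rightarrow> int \<Rightarrow> real) \<Rightarrow> (nat \<Rightarrow> int \<Rightarrow> real) \<Rightarrow>
   (int \<Rightarrow> 'a \<Rightarrow> real) \<Rightarrow> (int \<Rightarrow> 'a \<Rightarrow> real) \<Rightarrow> bool" where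
  "has_explicit_form M p q \<phi>0 \<phi> \<theta> \<epsilon> y \<longleftrightarrow>
     (\<forall>t. (\<lambda>r. xi p \<phi> t r * \<phi>0 r) summable_on {..t} \<and>
          (\<exists>Z. has_L2_sum M (\<lambda>r \<omega>. xi_q p q \<phi> \<theta> t r * \<epsilon> r \<omega>) t Z \<and>
               (AE \<omega> in M. y t \<omega> = (\<Sum>\<^sub>\<infinity>r\<in>{..t}. xi p \<phi> t r * \<phi>0 r) + Z \<omega>)))"

definition past :: "'a measure \<Rightarrow> (int \<Rightarrow> 'a \<Rightarrow> real) \<Rightarrow> int \<Rightarrow> 'a measure" where
  "past M y t =
     sigma (space M) {y s -` A \<inter> space M | s A. s < t \<and> A \<in> sets borel}"

text \<open>
  To be used only for \<open>y\<close> with measurable \<open>y s\<close> (as holds for an \<open>L2_solution\<close>), so that \<open>past M y t\<close> is a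
  subalgebra of \<open>M\<close>; otherwise \<open>real_cond_exp\<close> is 0 by default.
\<close>

definition innovations :: "'a measure \<Rightarrow> (int \<Rightarrow> 'a \<Rightarrow> real) \<Rightarrow> (int \<Rightarrow> 'a \<Rightarrow> real) \<Rightarrow> bool" where
  "innovations M y \<epsilon> \<longleftrightarrow> (\<forall>t. AE \<omega> in M. real_cond_exp M (past M y t) (\<epsilon> t) \<omega> = 0)"

end

theory Submission
  imports Defs
begin

text \<open>
  Expanding the determinant along its last row shows that \<open>\<xi>(t, s)\<close> solves the homogeneous difference
  equation in \<open>t\<close> with a unit impulse at \<open>t = s\<close>; \<open>\<xi>\<^sub>q\<close> then solves it with the impulse response of the
  moving average part. Since \<open>\<xi>\<^sub>q(t, \<cdot>)\<close> is absolutely summable and the errors are bounded in \<open>L\<^sub>2\<close>,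
  the random series converges absolutely almost surely, and its square is dominated, via a weighted
  Cauchy-Schwarz inequality, by an integrable function, which gives convergence in \<open>L\<^sub>2\<close>. The
  equation can therefore be verified pointwise, term by term.
\<close>

section \<open>The difference equations of the principal determinant and of its moving average
  version\<close>

text \<open>Deleting the last row and column \<open>j\<close> leaves a block lower triangular
  matrix: the leading \<open>j\<close> by \<open>j\<close> block, and a triangular block with
  diagonal -1. The factor (-1)^(k-j) from the latter cancels the cofactor sign (-1)^(k+j), so no
  signs survive in the expansion.\<close>

lemma det_lower_hessenberg_last_row:
  fixes f :: "nat \<times> nat \<Rightarrow> real"
  assumes super: "\<And>i. f (i, Suc i) = -1"
    and zero: "\<And>i j. Suc i < j \<Longrightarrow> f (i, j) = 0"
  shows "Determinant.det (mat (Suc k) (Suc k) f) = (\<Sum>j\<le>k. f (k, j) * Determinant.det (mat j j f))"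
proof -
  let ?A = "mat (Suc k) (Suc k) f"
  have cof: "cofactor ?A k j = Determinant.det (mat j j f)" if "j \<le> k" for j
  proof -
    define C where "C = mat (k - j) j (\<lambda>(a, b). f (a + j, b))"
    \<comment> \<open>Removing column \<open>j\<close> moves the later columns one place to the
      left, so the superdiagonal of \<open>f\<close> becomes the diagonal of
      \<open>D\<close>.\<close>
    define D where "D = mat (k - j) (k - j) (\<lambda>(a, b). f (a + j, Suc (b + j)))"
    have "mat_delete ?A k j = four_block_mat (mat j j f) (0\<^sub>m j (k - j)) C D"
      using that zero by (intro eq_matI) (auto simp: mat_delete_def C_def D_def)
    moreover have "Determinant.det (four_block_mat (mat j j f) (0\<^sub>m j (k - j)) C D) =
        Determinant.det (mat j j f) * Determinant.det D"
      by (rule det_four_block_mat_upper_right_zero[where n = j and m = "k - j"])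
        (auto simp: C_def D_def)
    ultimately have "Determinant.det (mat_delete ?A k j) = Determinant.det (mat j j f) * Determinant.det D"
      by simp
    also have "Determinant.det D = prod_list (diag_mat D)"
      by (rule det_lower_triangular[where n = "k - j"]) (auto simp: D_def zero)
    also have "diag_mat D = replicate (k - j) (-1)"
      by (rule nth_equalityI) (auto simp: diag_mat_def D_def super)
    finally show ?thesis
      using that by (auto simp: cofactor_def simp flip: power_add minus_one_power_iff)
  qed
  have "Determinant.det ?A = (\<Sum>j<Suc k. ?A $$ (k, j) * cofactor ?A k j)"
    by (rule laplace_expansion_row) auto
  also have "\<dots> = (\<Sum>j\<le>k. f (k, j) * Determinant.det (mat j j f))"
    by (simp only: lessThan_Suc_atMost) (intro sum.cong, auto simp: cof)
  finally show ?thesis .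
qed

text \<open>The last row of the principal matrix holds the coefficients at time \<open>t\<close>,
  and its leading minors are the values of \<open>xi\<close> at earlier times. The assumption
  \<open>p \<ge> 1\<close> matters because truncated subtraction makes \<open>p - 1\<close> equal to
  0 at \<open>p = 0\<close>, which would keep the diagonal in the matrix.\<close>

lemma xi_rec:
  assumes "p \<ge> 1"
  shows "xi p \<phi> t s = of_bool (t = s) + (\<Sum>m = 1..p. \<phi> m t * xi p \<phi> (t - int m) s)"
proof (cases "s < t")
  case False
  then show ?thesis by (auto simp: xi_def)
next
  case True
  define k where "k = nat (t - s) - 1"
  define f where "f = (\<lambda>(i, j). if j \<le> i \<and> i - j \<le> p - 1 then \<phi> (i - j + 1) (s + int i + 1)
                 else if j = i + 1 then -1 else (0::real))"
  have t: "t = s + int (Suc k)" using True by (simp add: k_def)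
  \<comment> \<open>The entries do not depend on the final time, so one function \<open>f\<close>
    serves for all leading blocks; the empty block has determinant 1, matching \<open>xi\<close> at
    equal times.\<close>
  have det: "Determinant.det (mat j j f) = xi p \<phi> (s + int j) s" for j
    by (auto simp: xi_def principal_matrix_def f_def)
  have "xi p \<phi> t s = (\<Sum>j\<le>k. f (k, j) * xi p \<phi> (s + int j) s)"
    unfolding t det[symmetric] by (rule det_lower_hessenberg_last_row) (auto simp: f_def)
  also have "\<dots> = (\<Sum>m\<in>{1..Suc k}. f (k, Suc k - m) * xi p \<phi> (t - int m) s)"
    by (rule sum.reindex_bij_witness[of _ "\<lambda>m. Suc k - m" "\<lambda>j. Suc k - j"]) (auto simp: t of_nat_diff)
  \<comment> \<open>The two ranges differ only by zero terms: for \<open>m > p\<close> the entry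
    lies outside the band, and for \<open>m > Suc k\<close> the time \<open>t - int m\<close>
    precedes \<open>s\<close>, where \<open>xi\<close> vanishes.\<close>
  also have "\<dots> = (\<Sum>m\<in>{1..p}. \<phi> m t * xi p \<phi> (t - int m) s)"
  proof (rule sum.mono_neutral_cong)
    fix m assume "m \<in> {1..Suc k} \<inter> {1..p}"
    then have "f (k, Suc k - m) = \<phi> m t" by (auto simp: f_def t Suc_diff_Suc algebra_simps)
    then show "f (k, Suc k - m) * xi p \<phi> (t - int m) s = \<phi> m t * xi p \<phi> (t - int m) s" by simp
  qed (use assms in \<open>auto simp: f_def t xi_def\<close>)
  finally show ?thesis using True by simp
qed

lemma xi_q_eq_0: "t < r \<Longrightarrow> xi_q p q \<phi> \<theta> t r = 0"
  by (auto simp: xi_q_def xi_def)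

text \<open>As a function of \<open>t\<close>, \<open>xi_q\<close> is a linear combination of
  solutions \<open>xi\<close> with weights free of \<open>t\<close>. The unit impulses of its
  summands sit at \<open>t = r\<close> and \<open>t = r + int l\<close>.\<close>

lemma xi_q_rec:
  assumes "p \<ge> 1"
  shows "xi_q p q \<phi> \<theta> t r =
    of_bool (t = r) + (\<Sum>l = 1..q. of_bool (t = r + int l) * \<theta> l t)
    + (\<Sum>m = 1..p. \<phi> m t * xi_q p q \<phi> \<theta> (t - int m) r)"
proof -
  have "(\<Sum>m = 1..p. \<phi> m t * xi_q p q \<phi> \<theta> (t - int m) r) =
     (\<Sum>m = 1..p. \<phi> m t * xi p \<phi> (t - int m) r) +
     (\<Sum>l = 1..q. (\<Sum>m = 1..p. \<phi> m t * xi p \<phi> (t - int m) (r + int l)) * \<theta> l (r + int l))"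
    unfolding xi_q_def distrib_left sum.distrib sum_distrib_left sum_distrib_right
    by (subst sum.swap) (simp add: mult.assoc)
  moreover have "(\<Sum>m = 1..p. \<phi> m t * xi p \<phi> (t - int m) u) = xi p \<phi> t u - of_bool (t = u)" for u
    using xi_rec[OF assms, of \<phi> t u] by simp
  moreover have "(\<Sum>l = 1..q. of_bool (t = r + int l) * \<theta> l t) = (\<Sum>l = 1..q. of_bool (t = r + int l) * \<theta> l (r + int l))"
    by (intro sum.cong) auto
  ultimately show ?thesis
    by (simp add: xi_q_def left_diff_distrib sum_subtractf)
qed

section \<open>Almost sure and mean-square convergence of weighted series\<close>

text \<open>Splitting the weight as \<open>sqrt \<bar>c n\<bar>\<close> times itself yields a bound
  that is linear in the squares of \<open>x n\<close>. Such a bound can be integrated term by term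
  when the \<open>x n\<close> are random.\<close>

lemma weighted_Cauchy_Schwarz_suminf:
  fixes c x :: "nat \<Rightarrow> real"
  assumes c: "summable (\<lambda>n. \<bar>c n\<bar>)" and cx: "summable (\<lambda>n. \<bar>c n\<bar> * (x n)\<^sup>2)"
  shows "summable (\<lambda>n. \<bar>c n * x n\<bar>)"
    and "(\<Sum>n. \<bar>c n * x n\<bar>)\<^sup>2 \<le> (\<Sum>n. \<bar>c n\<bar>) * (\<Sum>n. \<bar>c n\<bar> * (x n)\<^sup>2)"
proof -
  show s: "summable (\<lambda>n. \<bar>c n * x n\<bar>)"
  proof (rule summable_comparison_test')
    show "summable (\<lambda>n. \<bar>c n\<bar> + \<bar>c n\<bar> * (x n)\<^sup>2)" by (intro summable_add assms)
    fix n
    have "\<bar>x n\<bar> \<le> 1 + (x n)\<^sup>2"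
      using zero_le_power2[of "\<bar>x n\<bar> - 1"] by (simp add: power2_diff)
    then have "\<bar>c n\<bar> * \<bar>x n\<bar> \<le> \<bar>c n\<bar> * (1 + (x n)\<^sup>2)" by (intro mult_left_mono) auto
    then show "norm \<bar>c n * x n\<bar> \<le> \<bar>c n\<bar> + \<bar>c n\<bar> * (x n)\<^sup>2" by (simp add: abs_mult distrib_left)
  qed
  show "(\<Sum>n. \<bar>c n * x n\<bar>)\<^sup>2 \<le> (\<Sum>n. \<bar>c n\<bar>) * (\<Sum>n. \<bar>c n\<bar> * (x n)\<^sup>2)"
  proof (rule LIMSEQ_le)
    show "(\<lambda>N. (\<Sum>n<N. \<bar>c n * x n\<bar>)\<^sup>2) \<longlonglongrightarrow> (\<Sum>n. \<bar>c n * x n\<bar>)\<^sup>2"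
      by (intro tendsto_power summable_LIMSEQ s)
    show "(\<lambda>N. (\<Sum>n<N. \<bar>c n\<bar>) * (\<Sum>n<N. \<bar>c n\<bar> * (x n)\<^sup>2)) \<longlonglongrightarrow> (\<Sum>n. \<bar>c n\<bar>) * (\<Sum>n. \<bar>c n\<bar> * (x n)\<^sup>2)"
      by (intro tendsto_mult summable_LIMSEQ assms)
    have "(\<Sum>n<N. \<bar>c n * x n\<bar>)\<^sup>2 \<le> (\<Sum>n<N. \<bar>c n\<bar>) * (\<Sum>n<N. \<bar>c n\<bar> * (x n)\<^sup>2)" for N
    proof -
      have "\<bar>c n * x n\<bar> = sqrt \<bar>c n\<bar> * (sqrt \<bar>c n\<bar> * \<bar>x n\<bar>)" for n
        by (simp add: abs_mult flip: mult.assoc)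
      then show ?thesis
        using Cauchy_Schwarz_ineq_sum[of "\<lambda>n. sqrt \<bar>c n\<bar>" "\<lambda>n. sqrt \<bar>c n\<bar> * \<bar>x n\<bar>" "{..<N}"]
        by (simp add: power_mult_distrib)
    qed
    then show "\<exists>N0. \<forall>N\<ge>N0. (\<Sum>n<N. \<bar>c n * x n\<bar>)\<^sup>2 \<le> (\<Sum>n<N. \<bar>c n\<bar>) * (\<Sum>n<N. \<bar>c n\<bar> * (x n)\<^sup>2)"
      by blast
  qed
qed

text \<open>The weighted squares \<open>g n\<close> have integrals at most
  \<open>\<bar>c n\<bar> * B\<close>, so their series is integrable and finite almost everywhere.
  The weighted Cauchy-Schwarz inequality turns this into absolute convergence and an integrable
  majorant, and dominated convergence gives the limit in mean square.\<close>

lemma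
  fixes c :: "nat \<Rightarrow> real" and e :: "nat \<Rightarrow> 'a \<Rightarrow> real"
  assumes e: "\<And>n. e n \<in> L2 M" and bound: "\<And>n. (\<integral>\<omega>. (e n \<omega>)\<^sup>2 \<partial>M) \<le> B"
    and c: "summable (\<lambda>n. \<bar>c n\<bar>)"
  defines "Z \<equiv> \<lambda>\<omega>. \<Sum>n. c n * e n \<omega>"
  shows AE_summable_L2_bounded: "AE \<omega> in M. summable (\<lambda>n. \<bar>c n * e n \<omega>\<bar>)"
    and suminf_L2_bounded: "Z \<in> L2 M"
    and L2_convergence: "(\<lambda>N. \<integral>\<omega>. ((\<Sum>n<N. c n * e n \<omega>) - Z \<omega>)\<^sup>2 \<partial>M) \<longlonglongrightarrow> 0"
proof -
  have [measurable]: "e n \<in> borel_measurable M" and sq: "integrable M (\<lambda>\<omega>. (e n \<omega>)\<^sup>2)" for n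
    using e[of n] by (auto simp: L2_def)
  have [measurable]: "Z \<in> borel_measurable M" by (simp add: Z_def)
  define g where "g n \<omega> = \<bar>c n\<bar> * (e n \<omega>)\<^sup>2" for n \<omega>
  have g_nonneg: "0 \<le> g n \<omega>" for n \<omega> by (simp add: g_def)
  have g_int: "integrable M (g n)" for n unfolding g_def by (intro integrable_mult_right sq)
  have [measurable]: "g n \<in> borel_measurable M" for n using g_int by auto
  have int_nonneg: "0 \<le> (\<integral>\<omega>. g n \<omega> \<partial>M)" for n by (simp add: g_nonneg)
  have g_sum: "summable (\<lambda>n. \<integral>\<omega>. g n \<omega> \<partial>M)"
  proof (rule summable_comparison_test')
    show "summable (\<lambda>n. \<bar>c n\<bar> * B)" by (intro summable_mult2 c)
    show "norm (\<integral>\<omega>. g n \<omega> \<partial>M) \<le> \<bar>c n\<bar> * B" for n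
      using int_nonneg[of n] bound[of n] by (simp add: g_def mult_left_mono)
  qed
  \<comment> \<open>In \<open>ennreal\<close> sum and integral may be exchanged before any pointwise
    convergence is known; the finite total then yields it almost everywhere.\<close>
  have "(\<integral>\<^sup>+\<omega>. (\<Sum>n. ennreal (g n \<omega>)) \<partial>M) = (\<Sum>n. ennreal (\<integral>\<omega>. g n \<omega> \<partial>M))"
    by (subst nn_integral_suminf) (auto simp: nn_integral_eq_integral g_int g_nonneg)
  then have "(\<integral>\<^sup>+\<omega>. (\<Sum>n. ennreal (g n \<omega>)) \<partial>M) \<noteq> \<infinity>"
    using ennreal_suminf_neq_top[OF g_sum int_nonneg] by simp
  then have "AE \<omega> in M. (\<Sum>n. ennreal (g n \<omega>)) \<noteq> \<infinity>"
    by (intro nn_integral_PInf_AE) auto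
  then have AE_g: "AE \<omega> in M. summable (\<lambda>n. g n \<omega>)"
    by eventually_elim (auto intro: summable_suminf_not_top g_nonneg)
  show AE_ce: "AE \<omega> in M. summable (\<lambda>n. \<bar>c n * e n \<omega>\<bar>)"
    using AE_g by eventually_elim (rule weighted_Cauchy_Schwarz_suminf(1)[OF c], simp add: g_def)
  \<comment> \<open>One majorant for the square of the limit and for the squared errors of all
    partial sums.\<close>
  define w where "w \<omega> = (\<Sum>n. \<bar>c n\<bar>) * (\<Sum>n. g n \<omega>)" for \<omega>
  have w_int: "integrable M w"
    unfolding w_def using AE_g g_sum g_int
    by (intro integrable_mult_right integrable_suminf) (auto simp: g_nonneg)
  have AE_bound: "AE \<omega> in M. (\<Sum>n. \<bar>c n * e n \<omega>\<bar>)\<^sup>2 \<le> w \<omega>"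
    using AE_g unfolding w_def g_def
    by eventually_elim (rule weighted_Cauchy_Schwarz_suminf(2)[OF c])
  have "AE \<omega> in M. norm ((Z \<omega>)\<^sup>2) \<le> w \<omega>"
    using AE_ce AE_bound
  proof eventually_elim
    case (elim \<omega>)
    have "\<bar>Z \<omega>\<bar>\<^sup>2 \<le> (\<Sum>n. \<bar>c n * e n \<omega>\<bar>)\<^sup>2"
      unfolding Z_def by (intro power_mono summable_rabs elim) auto
    then show ?case using elim by simp
  qed
  then have "AE \<omega> in M. norm ((Z \<omega>)\<^sup>2) \<le> norm (w \<omega>)"
    by eventually_elim simp
  then have "integrable M (\<lambda>\<omega>. (Z \<omega>)\<^sup>2)"
    by (intro Bochner_Integration.integrable_bound[OF w_int]) auto
  then show "Z \<in> L2 M" by (simp add: L2_def)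
  have "(\<lambda>N. \<integral>\<omega>. ((\<Sum>n<N. c n * e n \<omega>) - Z \<omega>)\<^sup>2 \<partial>M) \<longlonglongrightarrow> (\<integral>\<omega>. 0 \<partial>M)"
  proof (rule integral_dominated_convergence[where w = w])
    show "integrable M w" by fact
    show "(\<lambda>_. 0) \<in> borel_measurable M" by simp
    show "(\<lambda>\<omega>. ((\<Sum>n<N. c n * e n \<omega>) - Z \<omega>)\<^sup>2) \<in> borel_measurable M" for N by measurable
    show "AE \<omega> in M. (\<lambda>N. ((\<Sum>n<N. c n * e n \<omega>) - Z \<omega>)\<^sup>2) \<longlonglongrightarrow> 0"
      using AE_ce
    proof eventually_elim
      case (elim \<omega>)
      have "(\<lambda>N. ((\<Sum>n<N. c n * e n \<omega>) - Z \<omega>)\<^sup>2) \<longlonglongrightarrow> (Z \<omega> - Z \<omega>)\<^sup>2"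
        unfolding Z_def
        by (intro tendsto_power tendsto_diff tendsto_const summable_LIMSEQ summable_rabs_cancel[OF elim])
      then show ?case by simp
    qed
    show "AE \<omega> in M. norm (((\<Sum>n<N. c n * e n \<omega>) - Z \<omega>)\<^sup>2) \<le> w \<omega>" for N
      using AE_ce AE_bound
    proof eventually_elim
      case (elim \<omega>)
      let ?x = "\<lambda>n. c n * e n \<omega>"
      have shift: "summable (\<lambda>n. \<bar>?x (n + N)\<bar>)"
        using elim(1) by (rule summable_ignore_initial_segment)
      \<comment> \<open>The error after \<open>N\<close> terms is a tail, which the full absolute
        series bounds uniformly in \<open>N\<close>.\<close>
      have "\<bar>(\<Sum>n<N. ?x n) - Z \<omega>\<bar> = \<bar>\<Sum>n. ?x (n + N)\<bar>"
        using suminf_split_initial_segment[of ?x N] summable_rabs_cancel[OF elim(1)] by (simp add: Z_def)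
      also have "\<dots> \<le> (\<Sum>n. \<bar>?x (n + N)\<bar>)" by (rule summable_rabs[OF shift])
      also have "\<dots> \<le> (\<Sum>n. \<bar>?x n\<bar>)"
        using suminf_split_initial_segment[OF elim(1), of N] by (simp add: sum_nonneg)
      finally have "\<bar>(\<Sum>n<N. ?x n) - Z \<omega>\<bar>\<^sup>2 \<le> (\<Sum>n. \<bar>?x n\<bar>)\<^sup>2" by (intro power_mono) auto
      then show ?case using elim(2) by simp
    qed
  qed
  then show "(\<lambda>N. \<integral>\<omega>. ((\<Sum>n<N. c n * e n \<omega>) - Z \<omega>)\<^sup>2 \<partial>M) \<longlonglongrightarrow> 0" by simp
qed

section \<open>Series over the integers and their termwise recurrences\<close>

lemma summable_on_atMost_int_iff:
  fixes f :: "int \<Rightarrow> real"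
  shows "f summable_on {..t} \<longleftrightarrow> (\<lambda>n. f (t - int n)) summable_on UNIV"
  by (rule summable_on_reindex_bij_witness[of _ "\<lambda>n. t - int n" "\<lambda>r. nat (t - r)"]) auto

text \<open>Summing over \<open>UNIV\<close> rather than \<open>{..t}\<close> gives the series for
  different times a common index set, so that they can be combined term by term.\<close>

lemma has_sum_atMost_int:
  fixes f :: "int \<Rightarrow> real"
  assumes "\<And>r. t < r \<Longrightarrow> f r = 0" and "summable (\<lambda>n. \<bar>f (t - int n)\<bar>)"
  shows "(f has_sum (\<Sum>n. f (t - int n))) UNIV"
proof -
  have "((\<lambda>n. f (t - int n)) has_sum (\<Sum>n. f (t - int n))) UNIV"
    using assms(2) by (intro norm_summable_imp_has_sum summable_sums) (auto intro: summable_rabs_cancel)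
  also have "?this \<longleftrightarrow> (f has_sum (\<Sum>n. f (t - int n))) {..t}"
    by (rule has_sum_reindex_bij_witness[of _ "\<lambda>r. nat (t - r)" "\<lambda>n. t - int n"]) auto
  also have "\<dots> \<longleftrightarrow> (f has_sum (\<Sum>n. f (t - int n))) UNIV"
    by (rule has_sum_cong_neutral) (auto simp: assms(1))
  finally show ?thesis .
qed

lemma has_L2_sum_bounded:
  assumes e: "\<And>r. e r \<in> L2 M" and bound: "\<And>r. (\<integral>\<omega>. (e r \<omega>)\<^sup>2 \<partial>M) \<le> B"
    and c: "summable (\<lambda>n. \<bar>c (t - int n)\<bar>)"
  shows "has_L2_sum M (\<lambda>r \<omega>. c r * e r \<omega>) t (\<lambda>\<omega>. \<Sum>n. c (t - int n) * e (t - int n) \<omega>)"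
  unfolding has_L2_sum_def
proof (intro conjI allI impI)
  let ?Z = "\<lambda>\<omega>. \<Sum>n. c (t - int n) * e (t - int n) \<omega>"
  show "(\<lambda>\<omega>. c r * e r \<omega>) \<in> L2 M" for r
    using e[of r] by (auto simp: L2_def power_mult_distrib)
  show "?Z \<in> L2 M"
    by (rule suminf_L2_bounded[OF e bound c])
  \<comment> \<open>The range \<open>s..t\<close> has \<open>t + 1 - s\<close> terms; for
    \<open>s > t\<close> both sums are empty because \<open>nat\<close> truncates at 0.\<close>
  have partial: "(\<Sum>n<nat (t + 1 - s). c (t - int n) * e (t - int n) \<omega>) = (\<Sum>r = s..t. c r * e r \<omega>)" for s \<omega>
    by (rule sum.reindex_bij_witness[of _ "\<lambda>r. nat (t - r)" "\<lambda>n. t - int n"]) auto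
  have "filterlim (\<lambda>s. nat (t + 1 - s)) sequentially at_bot"
    unfolding filterlim_at_top
  proof
    fix N show "\<forall>\<^sub>F s in at_bot. N \<le> nat (t + 1 - s)"
      using eventually_le_at_bot[of "t + 1 - int N"] by eventually_elim auto
  qed
  from filterlim_compose[OF L2_convergence[of "\<lambda>n. e (t - int n)", OF e bound c] this]
  show "((\<lambda>s. \<integral>\<omega>. ((\<Sum>r = s..t. c r * e r \<omega>) - ?Z \<omega>)\<^sup>2 \<partial>M) \<longlongrightarrow> 0) at_bot"
    by (simp add: partial)
qed

lemma has_sum_finite_sum:
  fixes f :: "'i \<Rightarrow> 'k \<Rightarrow> real"
  assumes "\<And>i. i \<in> I \<Longrightarrow> (f i has_sum s i) A"
  shows "((\<lambda>x. \<Sum>i\<in>I. f i x) has_sum (\<Sum>i\<in>I. s i)) A"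
  \<comment> \<open>For infinite \<open>I\<close> the sums over \<open>I\<close> are 0 by default,
    so that case is trivial.\<close>
  using assms by (induction I rule: infinite_finite_induct) (auto intro!: has_sum_add)

text \<open>Carries a recurrence of kernels over to the series they generate, by linearity and
  uniqueness of sums. It serves the drift with \<open>x\<close> as \<open>\<phi>0\<close> and the
  noise with \<open>x\<close> as a sample path of \<open>\<epsilon>\<close>.\<close>

lemma has_sum_recurrence:
  fixes x :: "'i \<Rightarrow> real"
  assumes "\<And>r. g r = d r + (\<Sum>m\<in>I. a m * h m r)"
    and "((\<lambda>r. g r * x r) has_sum Y) UNIV" and "((\<lambda>r. d r * x r) has_sum D) UNIV"
    and "\<And>m. m \<in> I \<Longrightarrow> ((\<lambda>r. h m r * x r) has_sum H m) UNIV"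
  shows "Y = D + (\<Sum>m\<in>I. a m * H m)"
proof -
  have "((\<lambda>r. d r * x r + (\<Sum>m\<in>I. a m * (h m r * x r))) has_sum (D + (\<Sum>m\<in>I. a m * H m))) UNIV"
    by (intro has_sum_add has_sum_finite_sum has_sum_cmult_right assms)
  moreover have "d r * x r + (\<Sum>m\<in>I. a m * (h m r * x r)) = g r * x r" for r
    by (simp add: assms(1) distrib_right sum_distrib_right mult.assoc)
  ultimately show ?thesis using assms(2) has_sum_unique by auto
qed

lemma has_sum_of_bool_eq: "((\<lambda>r. of_bool (t = r) * x r) has_sum (x t :: real)) UNIV"
  by (rule has_sum_finite_neutralI[where B = "{t}"]) auto

lemma (in finite_measure) L2_add_const:
  assumes "Z \<in> L2 M" shows "(\<lambda>\<omega>. a + Z \<omega>) \<in> L2 M"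
proof -
  have [measurable]: "Z \<in> borel_measurable M" and sq: "integrable M (\<lambda>\<omega>. (Z \<omega>)\<^sup>2)"
    using assms by (auto simp: L2_def)
  have "integrable M (\<lambda>\<omega>. 2 * a\<^sup>2 + 2 * (Z \<omega>)\<^sup>2)" using sq by simp
  then have "integrable M (\<lambda>\<omega>. (a + Z \<omega>)\<^sup>2)"
  proof (rule Bochner_Integration.integrable_bound)
    have "(a + z)\<^sup>2 \<le> 2 * a\<^sup>2 + 2 * z\<^sup>2" for z
      using zero_le_power2[of "a - z"] by (simp add: power2_sum power2_diff)
    then show "AE \<omega> in M. norm ((a + Z \<omega>)\<^sup>2) \<le> norm (2 * a\<^sup>2 + 2 * (Z \<omega>)\<^sup>2)" by simp
  qed simp
  then show ?thesis by (simp add: L2_def)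
qed


section \<open>Absolute summability of the kernels\<close>

lemma summable_on_mult_bounded:
  fixes f b :: "'i \<Rightarrow> real"
  assumes "(\<lambda>i. \<bar>f i\<bar>) summable_on A" and "bounded (range b)"
  shows "(\<lambda>i. \<bar>f i * b i\<bar>) summable_on A"
proof -
  obtain C where C: "\<And>i. \<bar>b i\<bar> \<le> C" using assms(2) by (auto simp: bounded_iff)
  show ?thesis
  proof (rule summable_on_comparison_test)
    show "(\<lambda>i. \<bar>f i\<bar> * C) summable_on A" by (intro summable_on_cmult_left assms)
    show "\<bar>f i * b i\<bar> \<le> \<bar>f i\<bar> * C" for i by (simp add: abs_mult C mult_left_mono)
  qed simp
qed

text \<open>Each summand of \<open>xi_q\<close> is a shift of \<open>xi\<close> times a bounded
  function. Since \<open>xi\<close> vanishes for \<open>r > t\<close>, the summability extends to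
  \<open>UNIV\<close>, which the shifts by \<open>l\<close> preserve, unlike
  \<open>{..t}\<close>.\<close>

lemma summable_on_xi_q:
  assumes xi: "(\<lambda>r. \<bar>xi p \<phi> t r\<bar>) summable_on {..t}"
    and \<theta>: "\<And>l. l \<in> {1..q} \<Longrightarrow> bounded (range (\<theta> l))"
  shows "(\<lambda>r. \<bar>xi_q p q \<phi> \<theta> t r\<bar>) summable_on UNIV"
proof -
  have xi_UNIV: "(\<lambda>r. \<bar>xi p \<phi> t r\<bar>) summable_on UNIV"
    using xi by (subst summable_on_cong_neutral[where T = "{..t}" and g = "\<lambda>r. \<bar>xi p \<phi> t r\<bar>"])
      (auto simp: xi_def)
  have shifted: "(\<lambda>r. \<bar>xi p \<phi> t (r + int l) * \<theta> l (r + int l)\<bar>) summable_on UNIV" if "l \<in> {1..q}" for l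
  proof -
    have "(\<lambda>r. \<bar>xi p \<phi> t r * \<theta> l r\<bar>) summable_on UNIV"
      by (intro summable_on_mult_bounded xi_UNIV \<theta> that)
    also have "?this \<longleftrightarrow> ?thesis"
      by (rule summable_on_reindex_bij_witness[of _ "\<lambda>r. r + int l" "\<lambda>r. r - int l"]) auto
    finally show ?thesis .
  qed
  have "(\<lambda>r. \<Sum>l = 1..q. \<bar>xi p \<phi> t (r + int l) * \<theta> l (r + int l)\<bar>) summable_on UNIV"
    by (rule has_sum_imp_summable, rule has_sum_finite_sum, rule has_sum_infsum, rule shifted)
  note bound = summable_on_add[OF xi_UNIV this]
  show ?thesis
  proof (rule summable_on_comparison_test)
    show "(\<lambda>r. \<bar>xi p \<phi> t r\<bar> + (\<Sum>l = 1..q. \<bar>xi p \<phi> t (r + int l) * \<theta> l (r + int l)\<bar>)) summable_on UNIV"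
      by (rule bound)
    show "\<bar>xi_q p q \<phi> \<theta> t r\<bar> \<le> \<bar>xi p \<phi> t r\<bar> + (\<Sum>l = 1..q. \<bar>xi p \<phi> t (r + int l) * \<theta> l (r + int l)\<bar>)" for r
      unfolding xi_q_def by (intro order_trans[OF abs_triangle_ineq] add_left_mono sum_abs)
  qed simp
qed

section \<open>Construction and verification of the solution\<close>

text \<open>The conditional mean condition on the errors mentions the process whose existence is
  claimed; it is therefore imposed on every process that solves the equation and has the explicit
  form.\<close>

theorem theorem3:
  fixes M :: "'a measure"
    and p q :: nat
    and \<phi>0 :: "int \<Rightarrow> real"
    and \<phi> \<theta> :: "nat \<Rightarrow> int \<Rightarrow> real"
    and \<epsilon> :: "int \<Rightarrow> 'a \<Rightarrow> real"
    and \<sigma> :: "int \<Rightarrow> real"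
  assumes "prob_space M"
    and "p \<ge> 1" and "q \<ge> 1"
    and "\<And>t. \<epsilon> t \<in> L2 M"
    and "\<And>t. (\<integral>\<omega>. \<epsilon> t \<omega> \<partial>M) = 0"
    and "\<And>s t. s \<noteq> t \<Longrightarrow> (\<integral>\<omega>. \<epsilon> t \<omega> * \<epsilon> s \<omega> \<partial>M) = 0"
    and "\<And>t. (\<integral>\<omega>. (\<epsilon> t \<omega>)\<^sup>2 \<partial>M) = (\<sigma> t)\<^sup>2"
    and "\<exists>B. \<forall>t. 0 < (\<sigma> t)\<^sup>2 \<and> (\<sigma> t)\<^sup>2 \<le> B"
    and "\<And>y. L2_solution M p q \<phi>0 \<phi> \<theta> \<epsilon> y \<Longrightarrow> has_explicit_form M p q \<phi>0 \<phi> \<theta> \<epsilon> y \<Longrightarrow> innovations M y \<epsilon>"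
    and "\<And>t. (\<lambda>r. \<bar>xi p \<phi> t r\<bar>) summable_on {..t}"
    and "bounded (range \<phi>0)"
    and "\<And>l. l \<in> {1..q} \<Longrightarrow> bounded (range (\<theta> l))"
  shows "\<exists>y. L2_solution M p q \<phi>0 \<phi> \<theta> \<epsilon> y \<and> has_explicit_form M p q \<phi>0 \<phi> \<theta> \<epsilon> y"
proof -
  interpret prob_space M by fact
  obtain B where B: "\<And>t. (\<sigma> t)\<^sup>2 \<le> B" using assms(8) by blast
  have bound: "(\<integral>\<omega>. (\<epsilon> t \<omega>)\<^sup>2 \<partial>M) \<le> B" for t by (simp add: assms(7) B)
  have xi_q_summable: "summable (\<lambda>n. \<bar>xi_q p q \<phi> \<theta> t (t - int n)\<bar>)" for t
  proof -
    have "(\<lambda>r. \<bar>xi_q p q \<phi> \<theta> t r\<bar>) summable_on {..t}"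
      using summable_on_xi_q[OF assms(10,12)] by (rule summable_on_subset_banach) auto
    then show ?thesis by (simp add: summable_on_atMost_int_iff summable_on_imp_summable)
  qed
  have drift_summable: "(\<lambda>r. xi p \<phi> t r * \<phi>0 r) summable_on {..t}" for t
    using summable_on_mult_bounded[OF assms(10,11)]
    by (subst summable_on_iff_abs_summable_on_real) simp
  define \<mu> where "\<mu> t = (\<Sum>\<^sub>\<infinity>r\<in>{..t}. xi p \<phi> t r * \<phi>0 r)" for t
  \<comment> \<open>A concrete pointwise representative of the mean-square limit, so that the
    equation can be checked path by path.\<close>
  define Z where "Z t \<omega> = (\<Sum>n. xi_q p q \<phi> \<theta> t (t - int n) * \<epsilon> (t - int n) \<omega>)" for t \<omega>
  define y where "y t \<omega> = \<mu> t + Z t \<omega>" for t \<omega>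
  have Z_sum: "has_L2_sum M (\<lambda>r \<omega>. xi_q p q \<phi> \<theta> t r * \<epsilon> r \<omega>) t (Z t)" for t
    unfolding Z_def by (rule has_L2_sum_bounded[OF assms(4) bound xi_q_summable])
  then have form: "has_explicit_form M p q \<phi>0 \<phi> \<theta> \<epsilon> y"
    unfolding has_explicit_form_def using drift_summable by (auto simp: y_def \<mu>_def)
  have y_L2: "y t \<in> L2 M" for t
    using Z_sum[of t] L2_add_const[of "Z t" "\<mu> t"] by (simp add: has_L2_sum_def y_def[abs_def])
  have "((\<lambda>r. xi p \<phi> t r * \<phi>0 r) has_sum \<mu> t) {..t}" for t
    unfolding \<mu>_def by (intro has_sum_infsum drift_summable)
  then have \<mu>_sum: "((\<lambda>r. xi p \<phi> t r * \<phi>0 r) has_sum \<mu> t) UNIV" for t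
    by (subst has_sum_cong_neutral[where T = "{..t}" and g = "\<lambda>r. xi p \<phi> t r * \<phi>0 r"])
      (auto simp: xi_def)
  \<comment> \<open>The unit impulse in \<open>xi_rec\<close> selects the single term
    \<open>\<phi>0 t\<close> from the drift series.\<close>
  have \<mu>_eq: "\<mu> t = \<phi>0 t + (\<Sum>m = 1..p. \<phi> m t * \<mu> (t - int m))" for t
    by (rule has_sum_recurrence[OF xi_rec[OF assms(2)] \<mu>_sum has_sum_of_bool_eq \<mu>_sum])
  \<comment> \<open>The impulses in \<open>xi_q_rec\<close> reproduce the moving average part of the
    equation at time \<open>t\<close>.\<close>
  have noise: "((\<lambda>r. (of_bool (t = r) + (\<Sum>l = 1..q. of_bool (t = r + int l) * \<theta> l t)) * x r)
      has_sum (x t + (\<Sum>l = 1..q. \<theta> l t * x (t - int l)))) UNIV" for t and x :: "int \<Rightarrow> real"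
  proof -
    have "((\<lambda>r. of_bool (t = r) * x r + (\<Sum>l = 1..q. \<theta> l t * (of_bool (t - int l = r) * x r)))
      has_sum (x t + (\<Sum>l = 1..q. \<theta> l t * x (t - int l)))) UNIV"
      by (intro has_sum_add has_sum_of_bool_eq has_sum_finite_sum has_sum_cmult_right)
    moreover have "of_bool (t = r) * x r + (\<Sum>l = 1..q. \<theta> l t * (of_bool (t - int l = r) * x r)) =
        (of_bool (t = r) + (\<Sum>l = 1..q. of_bool (t = r + int l) * \<theta> l t)) * x r" for r
      unfolding distrib_right sum_distrib_right diff_eq_eq by (simp only: mult_ac)
    ultimately show ?thesis by simp
  qed
  \<comment> \<open>The equation at time \<open>t\<close> also involves \<open>Z\<close> at the
    times \<open>t - int m\<close>; as the integers are countable, one null set serves all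
    times.\<close>
  have "AE \<omega> in M. \<forall>t. summable (\<lambda>n. \<bar>xi_q p q \<phi> \<theta> t (t - int n) * \<epsilon> (t - int n) \<omega>\<bar>)"
    unfolding AE_all_countable
    using AE_summable_L2_bounded[of "\<lambda>n. \<epsilon> (t - int n)" for t, OF assms(4) bound xi_q_summable] by blast
  then have "AE \<omega> in M. y t \<omega> = \<phi>0 t + (\<Sum>m = 1..p. \<phi> m t * y (t - int m) \<omega>)
      + \<epsilon> t \<omega> + (\<Sum>l = 1..q. \<theta> l t * \<epsilon> (t - int l) \<omega>)" for t
  proof eventually_elim
    case (elim \<omega>)
    have Z_has_sum: "((\<lambda>r. xi_q p q \<phi> \<theta> s r * \<epsilon> r \<omega>) has_sum Z s \<omega>) UNIV" for s
      unfolding Z_def using elim by (intro has_sum_atMost_int) (auto simp: xi_q_eq_0)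
    have "Z t \<omega> = \<epsilon> t \<omega> + (\<Sum>l = 1..q. \<theta> l t * \<epsilon> (t - int l) \<omega>)
        + (\<Sum>m = 1..p. \<phi> m t * Z (t - int m) \<omega>)"
      by (rule has_sum_recurrence[OF xi_q_rec[OF assms(2)] Z_has_sum noise Z_has_sum])
    then show ?case
      using \<mu>_eq[of t] by (simp add: y_def distrib_left sum.distrib)
  qed
  with y_L2 form show ?thesis by (auto simp: L2_solution_def)
qed

end
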